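(* Let $q\in(1,2)$ and $x\in I_q$. If $\Sigma_q(x)$ is uncountable, then $\operatorname{card}\Sigma_q(x)=2^{\aleph_0}$.
   Context: For $q\in(1,2)$, $I_q:=[0,\frac1{q-1}]$. For $x\in I_q$, $\Sigma_q(x)$ is the set of $q$-expansions of $x$: $$\Sigma_q(x)=\Big\{(\epsilon_i)_{i=1}^\infty\in\{0,1\}^{\mathbb N} : \sum_{i=1}^\infty \epsilon_i q^{-i}=x\Big\}.$$ *)

theory Defs
  imports "HOL-Analysis.Analysis"
begin

unbundle cardinal_syntax

definition I_q :: "real \<Rightarrow> real set" where
  "I_q q = {0 .. 1 / (q - 1)}"

text \<open>
  Digit sequences are indexed from \<open>0\<close>: the value \<open>\<epsilon> i\<close> is the digit with index \<open>i + 1\<close>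
  and hence has weight \<open>q\<close> to the power \<open>-(i + 1)\<close>.
\<close>

definition q_expansions :: "real \<Rightarrow> real \<Rightarrow> (nat \<Rightarrow> nat) set" where
  "q_expansions q x =
     {\<epsilon>. range \<epsilon> \<subseteq> {0, 1} \<and> (\<lambda>i. real (\<epsilon> i) / q ^ Suc i) sums x}"

end

theory Submission
  imports Defs "HOL-Library.Sublist"
begin

text \<open>
  The set of \<open>q\<close>-expansions of \<open>x\<close> is closed in the Cantor space of digit sequences: if every
  initial segment of \<open>f\<close> starts some expansion of \<open>x\<close>, then the partial sums of \<open>f\<close> differ from \<open>x\<close>
  by at most a tail of a convergent geometric series (\<open>q_expansions_limit_closed\<close>). So the theorem
  is the continuum hypothesis for closed sets, proved by Cantor and Bendixson.

  The argument for closed sets is this. Call a finite word \<^emph>\<open>big\<close> if it starts uncountably many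
  members of the set. There are only countably many words, so all but countably many members of the
  set have only big initial segments; hence every big word has two incompatible big
  extensions (\<open>uncountable_cylinder_splits\<close>). Iterating the splitting attaches to every binary
  sequence an increasing chain of big words, whose limit lies in the set by closedness; different
  binary sequences give different limits (\<open>cantor_lepoll_limit_closed\<close>). This gives at least
  continuum many expansions, and there are no more than that because the digits are binary.
\<close>

section \<open>Uncountable closed sets of sequences\<close>

definition cylinder :: "(nat \<Rightarrow> 'a) set \<Rightarrow> 'a list \<Rightarrow> (nat \<Rightarrow> 'a) set" where
  "cylinder S w = {f \<in> S. map f [0..<length w] = w}"

text \<open>
  Closedness in the product of discrete spaces, phrased through initial segments.
\<close>

definition limit_closed :: "(nat \<Rightarrow> 'a) set \<Rightarrow> bool" where
  "limit_closed S \<longleftrightarrow> (\<forall>f. (\<forall>n. \<exists>g\<in>S. \<forall>i<n. g i = f i) \<longrightarrow> f \<in> S)"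

lemma cylinder_prefix:
  assumes "map f [0..<m] = v" and "f \<in> cylinder S w" and "length w \<le> m"
  shows "prefix w v"
proof -
  have "[0..<m] = [0..<length w] @ [length w..<m]"
    using assms(3) by (metis le_add_diff_inverse upt_add_eq_append zero_le)
  then show ?thesis
    using assms(1,2) by (auto simp: cylinder_def prefix_def)
qed

text \<open>
  Removing the countably many members that pass through a word with countable cylinder leaves an
  uncountable set; long enough initial segments of two different members of it are the words sought.
\<close>

lemma uncountable_cylinder_splits:
  fixes S :: "(nat \<Rightarrow> 'a::countable) set"
  assumes "uncountable (cylinder S w)"
  obtains u v where "strict_prefix w u" "strict_prefix w v" "length u = length v" "u \<noteq> v"
    "uncountable (cylinder S u)" "uncountable (cylinder S v)"
proof -
  define T where "T = cylinder S w - (\<Union>t\<in>{t. countable (cylinder S t)}. cylinder S t)"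
  have "uncountable T"
    unfolding T_def using assms by (intro uncountable_minus_countable) auto
  then have "infinite T"
    using countable_finite by blast
  then obtain f where f: "f \<in> T"
    by (metis ex_in_conv finite.emptyI)
  have "infinite (T - {f})"
    using \<open>infinite T\<close> by simp
  then obtain g where g: "g \<in> T" "g \<noteq> f"
    by (metis DiffE ex_in_conv finite.emptyI insertI1)
  then obtain n where n: "g n \<noteq> f n"
    by auto
  define m where "m = Suc (max (length w) n)"
  have big: "uncountable (cylinder S (map h [0..<m]))"
    and pre: "strict_prefix w (map h [0..<m])" if "h \<in> T" for h
  proof -
    have "h \<in> cylinder S (map h [0..<m])"
      using that by (simp add: T_def cylinder_def)
    then show "uncountable (cylinder S (map h [0..<m]))"
      using that by (auto simp: T_def)
    have "prefix w (map h [0..<m])"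
      using that cylinder_prefix[of h m _ S w] by (simp add: T_def m_def)
    moreover have "length w \<noteq> length (map h [0..<m])"
      by (simp add: m_def)
    ultimately show "strict_prefix w (map h [0..<m])"
      by (auto simp: strict_prefix_def)
  qed
  have "n < m" by (simp add: m_def)
  then have "map f [0..<m] \<noteq> map g [0..<m]"
    using n by (auto intro!: bexI[of _ n])
  then show thesis
    using that[of "map f [0..<m]" "map g [0..<m]"] big pre f g(1) by simp
qed

text \<open>
  The Cantor scheme: starting from the empty word, a binary sequence selects at each step
  which of two incompatible big extensions to follow. The two have equal length, so that the limits
  of two binary sequences disagree at a position where the first words to differ disagree.
\<close>

theorem cantor_lepoll_limit_closed:
  fixes S :: "(nat \<Rightarrow> 'a::countable) set"
  assumes "limit_closed S" and "uncountable S"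
  shows "(UNIV :: (nat \<Rightarrow> bool) set) \<lesssim> S"
proof -
  define big where "big w \<longleftrightarrow> uncountable (cylinder S w)" for w
  have "\<exists>s. big w \<longrightarrow> strict_prefix w (s True) \<and> strict_prefix w (s False) \<and>
      length (s True) = length (s False) \<and> s True \<noteq> s False \<and> big (s True) \<and> big (s False)" for w
  proof (cases "big w")
    case True
    then have "uncountable (cylinder S w)"
      by (simp add: big_def)
    then obtain u v where "strict_prefix w u" "strict_prefix w v" "length u = length v" "u \<noteq> v"
        "uncountable (cylinder S u)" "uncountable (cylinder S v)"
      by (rule uncountable_cylinder_splits)
    then show ?thesis
      by (intro exI[of _ "\<lambda>b. if b then u else v"]) (simp add: big_def)
  qed simp
  then obtain s where s: "\<And>w. big w \<longrightarrow> strict_prefix w (s w True) \<and> strict_prefix w (s w False) \<and>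
      length (s w True) = length (s w False) \<and> s w True \<noteq> s w False \<and> big (s w True) \<and> big (s w False)"
    by metis
  have s_pre: "strict_prefix w (s w b)" and s_big: "big (s w b)" if "big w" for w b
    using s[of w] that by (cases b; simp)+
  have s_len: "length (s w b) = length (s w c)" if "big w" for w b c
    using s[of w] that by (cases b; cases c; simp)
  have s_neq: "s w b \<noteq> s w c" if "big w" "b \<noteq> c" for w b c
    using s[of w] that by (cases b; cases c; simp add: eq_commute[of "s w False"])
  define node :: "(nat \<Rightarrow> bool) \<Rightarrow> nat \<Rightarrow> 'a list"
    where "node h k = rec_nat [] (\<lambda>k w. s w (h k)) k" for h k
  have node_0: "node h 0 = []" and node_Suc: "node h (Suc k) = s (node h k) (h k)" for h k
    by (simp_all add: node_def)
  have node_big: "big (node h k)" for h k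
  proof (induction k)
    case 0
    then show ?case using assms(2) by (simp add: node_0 big_def cylinder_def)
  qed (simp add: node_Suc s_big)
  have node_prefix: "prefix (node h j) (node h k)" if "j \<le> k" for h j k
    using that
  proof (induction k rule: dec_induct)
    case (step k)
    then show ?case
      using s_pre[OF node_big[of h k]] by (metis node_Suc prefix_order.trans strict_prefix_def)
  qed simp
  have node_length: "k \<le> length (node h k)" for h k
  proof (induction k)
    case (Suc k)
    then show ?case
      using prefix_length_less[OF s_pre[OF node_big[of h k]]] by (metis Suc_leI node_Suc order_le_less_trans)
  qed simp
  have node_cong: "node h k = node h' k" if "\<forall>i<k. h i = h' i" for h h' k
    using that by (induction k) (simp_all add: node_0 node_Suc)
  \<comment> \<open>The limit of the chain: its word number \<open>Suc i\<close> is long enough to have an entry at \<open>i\<close>.\<close>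
  define F where "F h i = node h (Suc i) ! i" for h i
  have F_nth: "F h i = node h k ! i" if "i < length (node h k)" for h i k
  proof -
    have "i < length (node h (Suc i))"
      using node_length[of "Suc i" h] by simp
    moreover have "prefix (node h (Suc i)) (node h k) \<or> prefix (node h k) (node h (Suc i))"
      by (cases "k \<le> Suc i") (simp_all add: node_prefix)
    ultimately show ?thesis
      using that by (auto simp: F_def prefix_def nth_append)
  qed
  have "F h \<in> S" for h
  proof -
    have "\<exists>g\<in>S. \<forall>i<n. g i = F h i" for n
    proof -
      obtain g where "g \<in> cylinder S (node h n)"
        using node_big[of h n] unfolding big_def by (metis countable_empty ex_in_conv)
      then have "g \<in> S" and g: "map g [0..<length (node h n)] = node h n"
        by (auto simp: cylinder_def)
      have "g i = F h i" if "i < n" for i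
      proof -
        have i: "i < length (node h n)"
          using that node_length[of n h] by linarith
        then have "g i = map g [0..<length (node h n)] ! i" by simp
        then show ?thesis using F_nth[OF i] g by simp
      qed
      then show ?thesis using \<open>g \<in> S\<close> by blast
    qed
    then show ?thesis using assms(1) unfolding limit_closed_def by blast
  qed
  moreover have "inj F"
  proof (rule injI, rule ccontr)
    fix h h' assume eq: "F h = F h'" and "h \<noteq> h'"
    then have ex: "\<exists>k. h k \<noteq> h' k" by auto
    \<comment> \<open>Up to the first place where the binary sequences differ they select the same word.\<close>
    define k where "k = (LEAST k. h k \<noteq> h' k)"
    have k: "h k \<noteq> h' k" and less: "\<forall>i<k. h i = h' i"
      unfolding k_def using LeastI_ex[OF ex] not_less_Least by blast+
    define w where "w = node h k"
    have w: "node h (Suc k) = s w (h k)" "node h' (Suc k) = s w (h' k)"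
      using node_cong[OF less] by (simp_all add: node_Suc w_def)
    have "big w" by (simp add: w_def node_big)
    have "s w (h k) = s w (h' k)"
    proof (rule nth_equalityI)
      show len: "length (s w (h k)) = length (s w (h' k))"
        using s_len[OF \<open>big w\<close>] .
      fix i assume "i < length (s w (h k))"
      then show "s w (h k) ! i = s w (h' k) ! i"
        using F_nth[of i h "Suc k"] F_nth[of i h' "Suc k"] len eq by (simp add: w)
    qed
    then show False using s_neq[OF \<open>big w\<close> k] by contradiction
  qed
  ultimately show ?thesis
    unfolding lepoll_def by blast
qed

section \<open>Expansions in a non-integer base\<close>

lemma q_expansions_tail_bound:
  fixes q x :: real
  assumes "q > 1" and "g \<in> q_expansions q x"
  shows "\<bar>(\<Sum>i<n. real (g i) / q ^ Suc i) - x\<bar> \<le> (\<Sum>i. (1 / q) ^ Suc i) / q ^ n"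
proof -
  define c where "c i = real (g i) / q ^ Suc i" for i
  have g01: "g i \<le> 1" for i
    using assms(2) by (auto simp: q_expansions_def image_subset_iff)
      (metis One_nat_def le_eq_less_or_eq less_one zero_le)
  have c: "c sums x"
    using assms(2) by (simp add: q_expansions_def c_def[abs_def])
  have geo: "summable (\<lambda>i. (1 / q) ^ Suc i)"
    using assms(1) by (subst summable_Suc_iff) (simp add: summable_geometric)
  have tail: "(\<lambda>i. c (i + n)) sums (x - (\<Sum>i<n. c i))"
    using c by (rule sums_split_initial_segment)
  have nonneg: "0 \<le> c i" for i
    using assms(1) by (simp add: c_def)
  have le: "c (i + n) \<le> (1 / q) ^ Suc i / q ^ n" for i
    using g01[of "i + n"] assms(1)
    by (simp add: c_def power_add power_one_over field_simps)
  have "0 \<le> x - (\<Sum>i<n. c i)"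
    by (rule sums_le[OF _ sums_zero tail]) (rule nonneg)
  moreover have "x - (\<Sum>i<n. c i) \<le> (\<Sum>i. (1 / q) ^ Suc i) / q ^ n"
    by (rule sums_le[OF le tail]) (intro sums_divide summable_sums geo)
  ultimately show ?thesis
    by (simp add: c_def)
qed

lemma q_expansions_limit_closed:
  fixes q x :: real
  assumes "q > 1"
  shows "limit_closed (q_expansions q x)"
  unfolding limit_closed_def
proof (intro allI impI)
  fix f :: "nat \<Rightarrow> nat"
  assume approx: "\<forall>n. \<exists>g\<in>q_expansions q x. \<forall>i<n. g i = f i"
  have "range f \<subseteq> {0, 1}"
  proof
    fix y assume "y \<in> range f"
    then obtain i where "y = f i" by blast
    moreover obtain g where "g \<in> q_expansions q x" "g i = f i"
      using approx by (meson lessI)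
    ultimately show "y \<in> {0, 1}"
      unfolding q_expansions_def by (metis (no_types, lifting) mem_Collect_eq rangeI subsetD)
  qed
  moreover have "(\<lambda>i. real (f i) / q ^ Suc i) sums x"
    unfolding sums_def
  proof (rule LIM_zero_cancel, rule Lim_null_comparison)
    let ?C = "\<Sum>i. (1 / q) ^ Suc i"
    have "norm ((\<Sum>i<n. real (f i) / q ^ Suc i) - x) \<le> ?C / q ^ n" for n
    proof -
      obtain g where "g \<in> q_expansions q x" "\<forall>i<n. g i = f i"
        using approx by blast
      then show ?thesis
        using q_expansions_tail_bound[OF assms, of g x n] by simp
    qed
    then show "\<forall>\<^sub>F n in sequentially. norm ((\<Sum>i<n. real (f i) / q ^ Suc i) - x) \<le> ?C / q ^ n"
      by simp
    have "(\<lambda>n. ?C * (1 / q) ^ n) \<longlonglongrightarrow> ?C * 0"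
      using assms by (intro tendsto_mult tendsto_const LIMSEQ_power_zero) simp
    then show "(\<lambda>n. ?C / q ^ n) \<longlonglongrightarrow> 0"
      by (simp add: power_one_over)
  qed
  ultimately show "f \<in> q_expansions q x"
    by (simp add: q_expansions_def)
qed

lemma q_expansions_lepoll_cantor:
  "q_expansions q x \<lesssim> (UNIV :: (nat \<Rightarrow> bool) set)"
proof -
  have "inj_on (\<lambda>f i. f i = 1) (q_expansions q x)"
  proof (rule inj_onI, rule ext)
    fix f g :: "nat \<Rightarrow> nat" and i
    assume "f \<in> q_expansions q x" "g \<in> q_expansions q x"
      and eq: "(\<lambda>i. f i = 1) = (\<lambda>i. g i = 1)"
    then have "f i \<in> {0, 1}" "g i \<in> {0, 1}"
      unfolding q_expansions_def by blast+
    then show "f i = g i"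
      using fun_cong[OF eq, of i] by auto
  qed
  then show ?thesis
    unfolding lepoll_def by blast
qed

theorem theorem4p1:
  fixes q x :: real
  assumes "q \<in> {1<..<2}"
    and "x \<in> I_q q"
    and "uncountable (q_expansions q x)"
  shows "|q_expansions q x| =o ctwo ^c natLeq"
proof -
  have "(UNIV :: (nat \<Rightarrow> bool) set) \<lesssim> q_expansions q x"
    using assms by (intro cantor_lepoll_limit_closed q_expansions_limit_closed) auto
  then have "q_expansions q x \<approx> (UNIV :: (nat \<Rightarrow> bool) set)"
    using q_expansions_lepoll_cantor by (rule lepoll_antisym[rotated])
  moreover have "ctwo ^c natLeq = |UNIV :: (nat \<Rightarrow> bool) set|"
    by (simp add: cexp_def ctwo_def Field_card_of Field_natLeq Func_def)
  ultimately show ?thesis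
    by (simp add: eqpoll_iff_card_of_ordIso)
qed

end
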